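(* Every countable free group admits a pointy action.
   Context: For a finite alphabet $\Sigma$, the full shift $\Sigma^{\mathbb{Z}}$ carries the product topology and the shift homeomorphism $\sigma(x)_i = x_{i+1}$; $\mathrm{Aut}(\Sigma^{\mathbb{Z}})$ is the group of homeomorphisms of $\Sigma^{\mathbb{Z}}$ commuting with $\sigma$. If $\Sigma$ contains a distinguished symbol $0$, then $\mathrm{Aut}_0(\Sigma^{\mathbb{Z}})$ is the stabilizer of the constant point $0^{\mathbb{Z}}$ in $\mathrm{Aut}(\Sigma^{\mathbb{Z}})$, and $x\in\Sigma^{\mathbb{Z}}$ is $0$-finite if $\{i\in\mathbb{Z} : x_i\neq 0\}$ is finite. A subgroup $H\le \mathrm{Aut}_0(\Sigma^{\mathbb{Z}})$ is pointy if some $0$-finite $x_0\in\Sigma^{\mathbb{Z}}$ has free orbit under $H$, i.e. $h\mapsto hx_0$ is injective on $H$. A group $G$ admits a pointy action if, for some finite alphabet $\Sigma\ni 0$, there is an embedding of $G$ into $\mathrm{Aut}_0(\Sigma^{\mathbb{Z}})$ whose image is pointy. *)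

theory Defs
  imports "HOL-Analysis.Analysis" "HOL-Algebra.Bij"
begin

text \<open>A letter \<open>(s, True)\<close> stands for \<open>s\<close> and \<open>(s, False)\<close> for its inverse.
  A group is free on \<open>S\<close> if each of its elements is the value of exactly one reduced word over
  \<open>S\<close>.  The basis may be empty, finite or infinite.\<close>

definition reduced_word :: "('a \<times> bool) list \<Rightarrow> bool" where
  "reduced_word w \<longleftrightarrow> successively (\<lambda>(s, d) (t, e). s = t \<longrightarrow> d = e) w"

definition reduced_words :: "'a set \<Rightarrow> ('a \<times> bool) list set" where
  "reduced_words S = {w \<in> lists (S \<times> UNIV). reduced_word w}"

primrec word_eval :: "('a, 'b) monoid_scheme \<Rightarrow> ('a \<times> bool) list \<Rightarrow> 'a" where
  "word_eval G [] = \<one>\<^bsub>G\<^esub>"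
| "word_eval G (p # w) = (if snd p then fst p else inv\<^bsub>G\<^esub> (fst p)) \<otimes>\<^bsub>G\<^esub> word_eval G w"

definition free_basis :: "('a, 'b) monoid_scheme \<Rightarrow> 'a set \<Rightarrow> bool" where
  "free_basis G S \<longleftrightarrow>
     S \<subseteq> carrier G \<and> bij_betw (word_eval G) (reduced_words S) (carrier G)"

definition free_group :: "('a, 'b) monoid_scheme \<Rightarrow> bool" where
  "free_group G \<longleftrightarrow> group G \<and> (\<exists>S. free_basis G S)"

definition full_shift :: "'s set \<Rightarrow> (int \<Rightarrow> 's) topology" where
  "full_shift A = product_topology (\<lambda>_. discrete_topology A) UNIV"

definition shift :: "(int \<Rightarrow> 's) \<Rightarrow> int \<Rightarrow> 's" where
  "shift x = (\<lambda>i. x (i + 1))"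

text \<open>Automorphisms are extensional functions on the point set of the shift (as in
  \<^const>\<open>BijGroup\<close>), so that equality of group elements is equality of maps on
  that point set; multiplication is composition.\<close>

definition shift_Aut :: "'s set \<Rightarrow> ((int \<Rightarrow> 's) \<Rightarrow> (int \<Rightarrow> 's)) monoid" where
  "shift_Aut A = (BijGroup (topspace (full_shift A)))
     \<lparr>carrier := {f \<in> Bij (topspace (full_shift A)).
        homeomorphic_map (full_shift A) (full_shift A) f \<and>
        (\<forall>x \<in> topspace (full_shift A). f (shift x) = shift (f x))}\<rparr>"

definition shift_Aut0 :: "'s set \<Rightarrow> 's \<Rightarrow> ((int \<Rightarrow> 's) \<Rightarrow> (int \<Rightarrow> 's)) monoid" where
  "shift_Aut0 A z = (shift_Aut A)
     \<lparr>carrier := {f \<in> carrier (shift_Aut A). f (\<lambda>_. z) = (\<lambda>_. z)}\<rparr>"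

definition zero_finite :: "'s \<Rightarrow> (int \<Rightarrow> 's) \<Rightarrow> bool" where
  "zero_finite z x \<longleftrightarrow> finite {i. x i \<noteq> z}"

definition pointy :: "'s set \<Rightarrow> 's \<Rightarrow> ((int \<Rightarrow> 's) \<Rightarrow> (int \<Rightarrow> 's)) set \<Rightarrow> bool" where
  "pointy A z H \<longleftrightarrow> subgroup H (shift_Aut0 A z) \<and>
     (\<exists>x0 \<in> topspace (full_shift A). zero_finite z x0 \<and> inj_on (\<lambda>h. h x0) H)"

text \<open>Every finite alphabet can be relabelled by natural numbers, so letting the alphabet
  range over finite sets of naturals is no restriction.\<close>

definition admits_pointy_action :: "('a, 'b) monoid_scheme \<Rightarrow> bool" where
  "admits_pointy_action G \<longleftrightarrow>
     (\<exists>(A :: nat set) z \<phi>. finite A \<and> z \<in> A \<and>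
        \<phi> \<in> mon G (shift_Aut0 A z) \<and> pointy A z (\<phi> ` carrier G))"

end

theory Submission imports Defs begin

text \<open>
  The idea is to let an automorphism operate a stack that is written on the tape.  Let \<open>0\<close> be the
  blank, \<open>1\<close> a head, \<open>2\<close> a bottom marker and \<open>3\<close>, \<open>4\<close>, \<open>5\<close> stack letters.  For a letter \<open>l\<close> the
  local rule that exchanges the patterns \<open>s 1 0\<close> and \<open>s l 1\<close>, where \<open>s \<ge> 2\<close> and \<open>s \<noteq> l\<close>, is an
  involution in the stabilizer of the zero point.  On a point \<open>\<dots> 0 2 w 1 0 \<dots>\<close> whose stack \<open>w\<close>
  has no two equal neighbouring letters, it pops \<open>l\<close> if \<open>l\<close> is on top and pushes \<open>l\<close> otherwise.
  Hence the three involutions act on these points as the free product of three groups of order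
  two acts on its reduced words, and the orbit of the empty stack \<open>\<dots> 0 2 1 0 \<dots>\<close>, which is a
  \<open>0\<close>-finite point, is free.

  It remains to find a free subgroup of infinite rank.  Stacks are read from the top.  Write \<open>u\<^sub>n\<close> for the alternating word
  \<open>3 4 3 4 \<dots>\<close> of length \<open>n\<close>.  The involutions \<open>x\<^sub>n = u\<^sub>n 5 u\<^sub>n\<^sup>-\<^sup>1\<close> play ping-pong: \<open>x\<^sub>n\<close> takes the empty
  stack, and each stack that starts with \<open>u\<^sub>m 5\<close> for some \<open>m \<noteq> n\<close>, to a stack that starts with
  \<open>u\<^sub>n 5\<close> (lemma \<open>spike_act\<close>).  So a nonempty product of them in which neighbouring indices differ
  moves the empty stack (\<open>spikes_act\<close>).  Now send the \<open>k\<close>-th free generator to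
  \<open>x\<^bsub>2k\<^esub> x\<^bsub>2k+1\<^esub>\<close>, so that its inverse goes to \<open>x\<^bsub>2k+1\<^esub> x\<^bsub>2k\<^esub>\<close>.  A reduced word in the generators
  becomes, without any cancellation, a product with distinct neighbouring indices
  (\<open>distinct_adj_spike_word\<close>).  Thus a nontrivial element of the free group moves the
  empty stack, which shows at once that the action is faithful and that the orbit of this point is
  free.
\<close>

section \<open>Automorphisms of a full shift that fix a constant point\<close>

lemma topspace_full_shift: "topspace (full_shift A) = {x. \<forall>i. x i \<in> A}"
  by (auto simp: full_shift_def PiE_UNIV_domain)

text \<open>The easy half of the theorem of Curtis, Hedlund and Lyndon: a map each of whose output cells is
  determined by finitely many input cells is continuous, since the preimage of a set of values of
  one cell is a union of cylinders.\<close>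

lemma continuous_map_full_shift:
  assumes range: "\<And>x i. x \<in> topspace (full_shift A) \<Longrightarrow> f x i \<in> A"
    and fin: "\<And>i. finite (J i)"
    and local: "\<And>x y i. \<lbrakk>x \<in> topspace (full_shift A); y \<in> topspace (full_shift A);
                    \<forall>j\<in>J i. x j = y j\<rbrakk> \<Longrightarrow> f x i = f y i"
  shows "continuous_map (full_shift A) (full_shift A) f"
proof -
  have "continuous_map (full_shift A) (discrete_topology A) (\<lambda>x. f x i)" for i
    unfolding continuous_map_def
  proof (intro conjI allI impI)
    show "(\<lambda>x. f x i) \<in> topspace (full_shift A) \<rightarrow> topspace (discrete_topology A)"
      using range by auto
    fix V assume "openin (discrete_topology A) V"
    show "openin (full_shift A) {x \<in> topspace (full_shift A). f x i \<in> V}" (is "openin _ ?P")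
      unfolding full_shift_def openin_product_topology_alt
    proof
      fix x assume x: "x \<in> {x \<in> topspace (product_topology (\<lambda>_. discrete_topology A) UNIV). f x i \<in> V}"
      then have xA: "x j \<in> A" for j by (auto simp: PiE_UNIV_domain)
      \<comment> \<open>the cylinder of the points that agree with \<open>x\<close> on the window of cell \<open>i\<close>\<close>
      define U where "U j = (if j \<in> J i then {x j} else A)" for j
      have "{j. U j \<noteq> A} \<subseteq> J i" by (auto simp: U_def)
      then have "finite {j. U j \<noteq> A}" using fin finite_subset by blast
      moreover have "y \<in> ?P" if "y \<in> Pi\<^sub>E UNIV U" for y
      proof -
        have y: "y j \<in> U j" for j using that by auto
        then have "y j \<in> A" for j using xA by (metis U_def singletonD)
        moreover have "\<forall>j\<in>J i. x j = y j" using y by (metis U_def singletonD)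
        ultimately have "f x i = f y i"
          using x local[of x y i] by (auto simp: topspace_full_shift PiE_UNIV_domain)
        then show ?thesis
          using x \<open>\<And>j. y j \<in> A\<close> by (auto simp: topspace_full_shift)
      qed
      ultimately show "\<exists>U. finite {i \<in> UNIV. U i \<noteq> topspace (discrete_topology A)} \<and>
            (\<forall>i\<in>UNIV. openin (discrete_topology A) (U i)) \<and> x \<in> Pi\<^sub>E UNIV U \<and>
            Pi\<^sub>E UNIV U \<subseteq> {x \<in> topspace (product_topology (\<lambda>_. discrete_topology A) UNIV). f x i \<in> V}"
        using xA by (intro exI[of _ U]) (auto simp: U_def full_shift_def)
    qed
  qed
  then show ?thesis
    by (subst (2) full_shift_def) (simp add: continuous_map_componentwise_UNIV)
qed

lemma carrier_shift_Aut0: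
  "carrier (shift_Aut0 A z) = {f \<in> Bij (topspace (full_shift A)).
     homeomorphic_map (full_shift A) (full_shift A) f \<and>
     (\<forall>x \<in> topspace (full_shift A). f (shift x) = shift (f x)) \<and> f (\<lambda>_. z) = (\<lambda>_. z)}"
  by (auto simp: shift_Aut0_def shift_Aut_def)

lemma one_shift_Aut0: "\<one>\<^bsub>shift_Aut0 A z\<^esub> = (\<lambda>x\<in>topspace (full_shift A). x)"
  by (simp add: shift_Aut0_def shift_Aut_def BijGroup_def)

lemma mult_shift_Aut0:
  assumes "f \<in> carrier (shift_Aut0 A z)" "g \<in> carrier (shift_Aut0 A z)"
  shows "f \<otimes>\<^bsub>shift_Aut0 A z\<^esub> g = compose (topspace (full_shift A)) f g"
  using assms unfolding carrier_shift_Aut0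
  by (simp add: shift_Aut0_def shift_Aut_def BijGroup_def)

lemma shift_in_full_shift: "x \<in> topspace (full_shift A) \<Longrightarrow> shift x \<in> topspace (full_shift A)"
  by (simp add: topspace_full_shift shift_def)

text \<open>The stabilizer is a subgroup of the group of all bijections of the point set, which is where its
  multiplication and its extensional functions come from.\<close>

lemma group_shift_Aut0:
  assumes "z \<in> A"
  shows "group (shift_Aut0 A z)"
proof -
  let ?X = "topspace (full_shift A)"
  let ?C = "carrier (shift_Aut0 A z)"
  interpret B: group "BijGroup ?X" by (rule group_BijGroup)
  have z: "(\<lambda>_. z) \<in> ?X" using assms by (simp add: topspace_full_shift)
  have "subgroup ?C (BijGroup ?X)"
  proof (rule B.subgroupI)
    show "?C \<subseteq> carrier (BijGroup ?X)"
      by (auto simp: carrier_shift_Aut0 BijGroup_def)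
    have "homeomorphic_map (full_shift A) (full_shift A) (\<lambda>x\<in>?X. x)"
      by (rule homeomorphic_map_eq[of _ _ id]) (auto simp: homeomorphic_map_id)
    then have "(\<lambda>x\<in>?X. x) \<in> ?C"
      using z by (auto simp: carrier_shift_Aut0 id_Bij shift_in_full_shift)
    then show "?C \<noteq> {}" by blast
  next
    fix f assume f: "f \<in> ?C"
    let ?g = "\<lambda>x\<in>?X. inv_into ?X f x"
    have fB: "f \<in> Bij ?X" and bij: "bij_betw f ?X ?X" and sh: "\<And>x. x \<in> ?X \<Longrightarrow> f (shift x) = shift (f x)"
      and fz: "f (\<lambda>_. z) = (\<lambda>_. z)" and hf: "homeomorphic_map (full_shift A) (full_shift A) f"
      using f by (auto simp: carrier_shift_Aut0 Bij_def)
    have gf: "?g (f x) = x" if "x \<in> ?X" for x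
      using that bij by (simp add: bij_betw_inv_into_left bij_betw_apply)
    have fg: "f (?g x) = x" "?g x \<in> ?X" if "x \<in> ?X" for x
      using that bij by (simp_all add: bij_betw_inv_into_right bij_betw_def inv_into_into)
    obtain g where g: "homeomorphic_maps (full_shift A) (full_shift A) f g"
      using hf homeomorphic_map_maps by blast
    then have "homeomorphic_map (full_shift A) (full_shift A) g"
      by (simp add: homeomorphic_maps_map)
    moreover have "g x = ?g x" if "x \<in> ?X" for x
      using g gf[of "g x"] that homeomorphic_imp_surjective_map[OF \<open>homeomorphic_map _ _ g\<close>]
      by (force simp: homeomorphic_maps_map)
    ultimately have "homeomorphic_map (full_shift A) (full_shift A) ?g"
      by (rule homeomorphic_map_eq)
    moreover have "?g (shift x) = shift (?g x)" if "x \<in> ?X" for x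
    proof -
      have "f (shift (?g x)) = shift x" using sh[OF fg(2)] fg(1) that by metis
      then show ?thesis using gf[OF shift_in_full_shift[OF fg(2)[OF that]]] by metis
    qed
    moreover have "?g (\<lambda>_. z) = (\<lambda>_. z)" using gf[OF z] fz by simp
    ultimately have "?g \<in> ?C"
      using restrict_inv_into_Bij[OF fB] unfolding carrier_shift_Aut0 by blast
    then show "inv\<^bsub>BijGroup ?X\<^esub> f \<in> ?C" using inv_BijGroup[OF fB] by simp
  next
    fix f g assume f: "f \<in> ?C" and g: "g \<in> ?C"
    then have B: "f \<in> Bij ?X" "g \<in> Bij ?X" by (auto simp: carrier_shift_Aut0)
    have "homeomorphic_map (full_shift A) (full_shift A) (f \<circ> g)"
      using f g by (auto simp: carrier_shift_Aut0 intro: homeomorphic_map_compose)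
    then have "homeomorphic_map (full_shift A) (full_shift A) (compose ?X f g)"
      by (rule homeomorphic_map_eq) (simp add: compose_def)
    moreover have "g x \<in> ?X" if "x \<in> ?X" for x
      using B that by (auto dest: Bij_imp_funcset)
    ultimately have "compose ?X f g \<in> ?C"
      using f g z compose_Bij[OF B]
      by (auto simp: carrier_shift_Aut0 compose_def shift_in_full_shift)
    then show "f \<otimes>\<^bsub>BijGroup ?X\<^esub> g \<in> ?C"
      using B by (simp add: BijGroup_def)
  qed
  moreover have "shift_Aut0 A z = (BijGroup ?X)\<lparr>carrier := ?C\<rparr>"
    by (simp add: shift_Aut0_def shift_Aut_def)
  ultimately show ?thesis using B.subgroup_imp_group by metis
qed

section \<open>The local rule\<close>

text \<open>The two patterns that the rule for \<open>l\<close> exchanges, \<open>s 1 0\<close> and \<open>s l 1\<close>; the index \<open>i\<close> is the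
  middle cell.\<close>

definition pushable :: "nat \<Rightarrow> (int \<Rightarrow> nat) \<Rightarrow> int \<Rightarrow> bool" where
  "pushable l x i \<longleftrightarrow> x (i - 1) \<ge> 2 \<and> x (i - 1) \<noteq> l \<and> x i = 1 \<and> x (i + 1) = 0"

definition poppable :: "nat \<Rightarrow> (int \<Rightarrow> nat) \<Rightarrow> int \<Rightarrow> bool" where
  "poppable l x i \<longleftrightarrow> x (i - 1) \<ge> 2 \<and> x (i - 1) \<noteq> l \<and> x i = l \<and> x (i + 1) = 1"

text \<open>Cell \<open>i\<close> is rewritten if it is the middle or the last cell of one of the patterns.  The order
  of the cases is immaterial for \<open>l \<ge> 2\<close>, because then no cell is rewritten by two patterns.\<close>

definition toggle :: "nat \<Rightarrow> (int \<Rightarrow> nat) \<Rightarrow> int \<Rightarrow> nat" where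
  "toggle l x i =
     (if pushable l x i then l else if poppable l x i then 1
      else if pushable l x (i - 1) then 1 else if poppable l x (i - 1) then 0
      else x i)"

text \<open>The left neighbour \<open>s\<close> is only read.  No pattern rewrites it, because the cells that are rewritten
  hold \<open>1, 0\<close> or \<open>l, 1\<close> before and after, whereas \<open>s \<ge> 2\<close> and \<open>s \<noteq> l\<close>.  So all patterns in a point
  can be exchanged simultaneously, and the exchange creates no others.\<close>

lemma pushable_toggle:
  assumes "l \<ge> 2"
  shows "pushable l (toggle l x) i \<longleftrightarrow> poppable l x i"
proof
  assume p: "poppable l x i"
  then show "pushable l (toggle l x) i"
    using assms unfolding pushable_def toggle_def poppable_def
    by (auto simp: algebra_simps)
next
  assume p: "pushable l (toggle l x) i"
  have 1: "toggle l x (i - 1) = x (i - 1)"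
    using p assms unfolding pushable_def by (auto simp: toggle_def split: if_splits)
  show "poppable l x i"
  proof (rule ccontr)
    assume n: "\<not> poppable l x i"
    have 2: "\<not> pushable l x (i - 1)" "\<not> poppable l x (i - 1)"
      using p 1 assms by (auto simp: pushable_def poppable_def toggle_def split: if_splits)
    have 3: "\<not> pushable l x i"
      using p assms unfolding pushable_def[of l "toggle l x"] by (auto simp: toggle_def)
    have "x i = 1" "x (i + 1) = 0"
      using p assms n 2 3 unfolding pushable_def[of l "toggle l x"]
      by (auto simp: toggle_def split: if_splits)
    then show False using 1 3 p by (simp add: pushable_def)
  qed
qed

lemma poppable_toggle:
  assumes "l \<ge> 2"
  shows "poppable l (toggle l x) i \<longleftrightarrow> pushable l x i"
proof
  assume p: "pushable l x i"
  then show "poppable l (toggle l x) i"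
    using assms unfolding pushable_def toggle_def poppable_def
    by (auto simp: algebra_simps)
next
  assume p: "poppable l (toggle l x) i"
  have 1: "toggle l x (i - 1) = x (i - 1)"
    using p assms unfolding poppable_def by (auto simp: toggle_def split: if_splits)
  show "pushable l x i"
  proof (rule ccontr)
    assume n: "\<not> pushable l x i"
    have 2: "\<not> pushable l x (i - 1)" "\<not> poppable l x (i - 1)"
      using p 1 assms by (auto simp: pushable_def poppable_def toggle_def split: if_splits)
    have 3: "\<not> poppable l x i"
      using p n assms unfolding poppable_def[of l "toggle l x"] by (auto simp: toggle_def)
    have "x i = l"
      using p assms n 2 3 by (simp add: poppable_def[of l "toggle l x"] toggle_def)
    moreover from this have "\<not> poppable l x (i + 1)"
      by (simp add: poppable_def)
    with p assms n 3 have "x (i + 1) = 1"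
      by (simp add: poppable_def[of l "toggle l x"] toggle_def split: if_splits)
    ultimately show False using 1 3 p by (simp add: poppable_def)
  qed
qed

lemma toggle_toggle:
  assumes "l \<ge> 2"
  shows "toggle l (toggle l x) = x"
proof
  fix i
  show "toggle l (toggle l x) i = x i"
    unfolding toggle_def[of l "toggle l x"] pushable_toggle[OF assms] poppable_toggle[OF assms]
    by (auto simp: toggle_def pushable_def poppable_def)
qed

lemma toggle_shift: "toggle l (shift x) = shift (toggle l x)"
  by (rule ext) (simp add: toggle_def shift_def pushable_def poppable_def algebra_simps)

text \<open>Blank \<open>0\<close>, head \<open>1\<close>, bottom marker \<open>2\<close> and the stack letters \<open>3\<close>, \<open>4\<close>, \<open>5\<close>.  The bottom marker lets the
  rule read a left neighbour \<open>s \<ge> 2\<close> also when the stack is empty.\<close>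

abbreviation "stack_alphabet \<equiv> {..5::nat}"
abbreviation "stack_shift \<equiv> topspace (full_shift stack_alphabet)"

abbreviation stack_group :: "((int \<Rightarrow> nat) \<Rightarrow> (int \<Rightarrow> nat)) monoid" where
  "stack_group \<equiv> shift_Aut0 stack_alphabet 0"

lemma toggle_in_full_shift:
  assumes "x \<in> stack_shift" "l \<le> 5"
  shows "toggle l x \<in> stack_shift"
  using assms by (simp add: topspace_full_shift toggle_def)

lemma toggle_Aut0:
  assumes "2 \<le> l" "l \<le> 5"
  shows "restrict (toggle l) stack_shift \<in> carrier stack_group"
proof -
  have "continuous_map (full_shift stack_alphabet) (full_shift stack_alphabet) (toggle l)"
    by (rule continuous_map_full_shift[where J = "\<lambda>i. {i - 2, i - 1, i, i + 1}"])
      (use toggle_in_full_shift[of _ l] assms in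
        \<open>auto simp: topspace_full_shift toggle_def pushable_def poppable_def algebra_simps\<close>)
  then have "homeomorphic_map (full_shift stack_alphabet) (full_shift stack_alphabet) (toggle l)"
    by (rule homeomorphic_map_involution) (rule toggle_toggle[OF assms(1)])
  then have h: "homeomorphic_map (full_shift stack_alphabet) (full_shift stack_alphabet)
      (restrict (toggle l) stack_shift)"
    by (rule homeomorphic_map_eq) simp
  have "bij_betw (toggle l) stack_shift stack_shift"
    by (rule bij_betw_byWitness[where f' = "toggle l"])
      (use toggle_toggle toggle_in_full_shift assms in auto)
  then have "restrict (toggle l) stack_shift \<in> Bij stack_shift"
    by (simp add: Bij_def)
  moreover have "toggle l (\<lambda>_. 0) = (\<lambda>_. 0)"
    using assms by (auto simp: toggle_def pushable_def poppable_def)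
  moreover have "restrict (toggle l) stack_shift (shift x) = shift (restrict (toggle l) stack_shift x)"
    if "x \<in> stack_shift" for x
    using that by (simp add: toggle_shift shift_in_full_shift)
  moreover have "(\<lambda>_. 0) \<in> stack_shift" by (simp add: topspace_full_shift)
  ultimately show ?thesis
    using h by (simp add: carrier_shift_Aut0)
qed

text \<open>Products of the involutions, made extensional only once at the end, so that their action on points
  is a plain \<^const>\<open>foldr\<close>.\<close>

definition toggles :: "nat list \<Rightarrow> (int \<Rightarrow> nat) \<Rightarrow> (int \<Rightarrow> nat)" where
  "toggles v = restrict (foldr toggle v) stack_shift"

lemma toggles_Nil: "toggles [] = \<one>\<^bsub>stack_group\<^esub>"
  by (simp add: toggles_def one_shift_Aut0 id_def)

lemma foldr_toggle_in_full_shift: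
  "set v \<subseteq> {2..5} \<Longrightarrow> x \<in> stack_shift \<Longrightarrow> foldr toggle v x \<in> stack_shift"
  by (induction v) (auto intro!: toggle_in_full_shift)

lemma toggles_Aut0: "set v \<subseteq> {2..5} \<Longrightarrow> toggles v \<in> carrier stack_group"
proof (induction v)
  case Nil
  interpret H: group stack_group by (rule group_shift_Aut0) simp
  show ?case unfolding toggles_Nil by simp
next
  case (Cons l v)
  interpret H: group stack_group by (rule group_shift_Aut0) simp
  have l: "restrict (toggle l) stack_shift \<in> carrier stack_group"
    using toggle_Aut0 Cons.prems by simp
  have v: "toggles v \<in> carrier stack_group" using Cons by simp
  have "toggles (l # v) = restrict (toggle l) stack_shift \<otimes>\<^bsub>stack_group\<^esub> toggles v"
    unfolding mult_shift_Aut0[OF l v]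
    using Cons.prems
    by (auto simp: toggles_def compose_def foldr_toggle_in_full_shift fun_eq_iff restrict_def)
  then show ?case using l v by simp
qed

lemma toggles_append:
  assumes "set v \<subseteq> {2..5}" "set w \<subseteq> {2..5}"
  shows "toggles (v @ w) = toggles v \<otimes>\<^bsub>stack_group\<^esub> toggles w"
  unfolding mult_shift_Aut0[OF toggles_Aut0[OF assms(1)] toggles_Aut0[OF assms(2)]]
  using assms
  by (auto simp: toggles_def compose_def foldr_toggle_in_full_shift fun_eq_iff restrict_def)

lemma toggles_rev:
  assumes "set v \<subseteq> {2..5}"
  shows "toggles (rev v) = inv\<^bsub>stack_group\<^esub> toggles v"
proof -
  interpret H: group stack_group by (rule group_shift_Aut0) simp
  have "foldr toggle (rev v @ v) x = x" for x
    using assms by (induction v arbitrary: x) (auto simp: toggle_toggle)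
  then have "toggles (rev v @ v) = toggles []"
    unfolding toggles_def by (metis foldr_Nil id_apply restrict_ext)
  then have "toggles (rev v) \<otimes>\<^bsub>stack_group\<^esub> toggles v = \<one>\<^bsub>stack_group\<^esub>"
    using assms toggles_append[of "rev v" v] toggles_Nil by simp
  then show ?thesis
    using assms by (intro H.inv_equality[symmetric]) (auto simp: toggles_Aut0)
qed

section \<open>Stacks\<close>

text \<open>The point \<open>\<dots> 0 2 w 1 0 \<dots>\<close> with the bottom marker in cell \<open>0\<close>.  The first entry of the list is the
  top of the stack and is written next to the head, so the tape shows the list in reverse.\<close>

primrec stack_config :: "nat list \<Rightarrow> int \<Rightarrow> nat" where
  "stack_config [] = (\<lambda>_. 0)(0 := 2, 1 := 1)"
| "stack_config (l # w) =
     (stack_config w)(int (length w) + 1 := l, int (length w) + 2 := 1)"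

lemma stack_config_beyond: "i > int (length w) + 1 \<Longrightarrow> stack_config w i = 0"
  by (induction w) auto

lemma stack_config_top: "stack_config w (int (length w)) = hd (w @ [2])"
  by (cases w) auto

lemma stack_config_head:
  "\<forall>t\<in>set w. t \<ge> 2 \<Longrightarrow> stack_config w i = 1 \<longleftrightarrow> i = int (length w) + 1"
  by (induction w) auto

text \<open>Both patterns contain a head, and there is only one.  With a top other than \<open>l\<close>, only the
  pattern \<open>s 1 0\<close> fits.\<close>

lemma toggle_push:
  assumes "\<forall>t\<in>set w. t \<ge> 2" "l > 2" "w = [] \<or> hd w \<noteq> l"
  shows "toggle l (stack_config w) = stack_config (l # w)"
proof
  fix i
  have top: "hd (w @ [2]) \<ge> 2" "hd (w @ [2]) \<noteq> l"
    using assms by (cases w; auto)+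
  have 1: "pushable l (stack_config w) i \<longleftrightarrow> i = int (length w) + 1" for i
    using top stack_config_top[of w] stack_config_head[OF assms(1)]
    by (auto simp: pushable_def stack_config_beyond)
  have 2: "\<not> poppable l (stack_config w) i" for i
    using top stack_config_top[of w] stack_config_head[OF assms(1)]
    by (auto simp: poppable_def)
  show "toggle l (stack_config w) i = stack_config (l # w) i"
    unfolding toggle_def 1 using 2 by auto
qed

fun stack_act :: "'a \<Rightarrow> 'a list \<Rightarrow> 'a list" where
  "stack_act l [] = [l]"
| "stack_act l (t # w) = (if t = l then w else l # t # w)"

lemma distinct_adj_stack_act: "distinct_adj w \<Longrightarrow> distinct_adj (stack_act l w)"
  by (cases w) (auto simp: distinct_adj_Cons)

lemma set_stack_act: "set (stack_act l w) \<subseteq> insert l (set w)"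
  by (cases w) auto

text \<open>Popping needs no computation of its own: it undoes a push.  Here it matters that equal letters are never
  adjacent, for otherwise the letter below the top would block the rule.\<close>

lemma toggle_stack_config:
  assumes "distinct_adj w" "\<forall>t\<in>set w. t \<ge> 2" "l > 2"
  shows "toggle l (stack_config w) = stack_config (stack_act l w)"
proof (cases "w \<noteq> [] \<and> hd w = l")
  case True
  then obtain r where r: "w = l # r" by (cases w) auto
  have "toggle l (stack_config r) = stack_config w"
    unfolding r by (rule toggle_push) (use assms r in \<open>auto simp: distinct_adj_Cons\<close>)
  then have "toggle l (stack_config w) = stack_config r"
    using toggle_toggle[of l "stack_config r"] assms by simp
  then show ?thesis by (simp add: r)
next
  case False
  then show ?thesis using toggle_push[of w l] assms by (cases w) auto
qed

lemma foldr_stack_act: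
  assumes "distinct_adj w" "\<forall>t\<in>set w. t > 2" "\<forall>t\<in>set v. t > 2"
  shows "foldr toggle v (stack_config w) = stack_config (foldr stack_act v w)"
    and "distinct_adj (foldr stack_act v w)"
    and "\<forall>t\<in>set (foldr stack_act v w). t > 2"
proof -
  have "foldr toggle v (stack_config w) = stack_config (foldr stack_act v w)
     \<and> distinct_adj (foldr stack_act v w) \<and> (\<forall>t\<in>set (foldr stack_act v w). t > 2)"
    using assms(3)
  proof (induction v)
    case Nil
    then show ?case using assms by simp
  next
    case (Cons l v)
    then show ?case
      using toggle_stack_config[of "foldr stack_act v w" l]
        distinct_adj_stack_act[of "foldr stack_act v w" l]
        set_stack_act[of l "foldr stack_act v w"]
      by (fastforce intro: less_imp_le)
  qed
  then show "foldr toggle v (stack_config w) = stack_config (foldr stack_act v w)"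
    and "distinct_adj (foldr stack_act v w)"
    and "\<forall>t\<in>set (foldr stack_act v w). t > 2" by auto
qed

lemma foldr_stack_act_push: "distinct_adj (v @ w) \<Longrightarrow> foldr stack_act v w = v @ w"
proof (induction v)
  case (Cons a v)
  then have "foldr stack_act v w = v @ w" by (auto simp: distinct_adj_Cons)
  with Cons.prems show ?case by (cases "v @ w") auto
qed simp

lemma foldr_stack_act_pop: "foldr stack_act (rev v) (v @ w) = w"
  by (induction v) auto

section \<open>Ping-pong\<close>

text \<open>The word \<open>zigzag n\<close> is \<open>u\<^sub>n\<close>.  Letters act as involutions, so reversing a word inverts it, and the
  palindrome \<open>spike n\<close> stands for the conjugate \<open>x\<^sub>n\<close> of the letter \<open>5\<close> by \<open>u\<^sub>n\<close>.\<close>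

definition zigzag :: "nat \<Rightarrow> nat list" where
  "zigzag n = map (\<lambda>i. if even i then 3 else 4) [0..<n]"

definition spike :: "nat \<Rightarrow> nat list" where
  "spike n = zigzag n @ [5] @ rev (zigzag n)"

lemma rev_spike: "rev (spike n) = spike n"
  by (simp add: spike_def)

lemma set_zigzag: "set (zigzag n) \<subseteq> {3, 4}"
  by (auto simp: zigzag_def)

lemma distinct_adj_zigzag: "distinct_adj (zigzag n)"
  by (auto simp: zigzag_def distinct_adj_conv_nth)

lemma zigzag_prefix: 
  assumes "m < n"
  obtains v where "zigzag n = zigzag m @ v" "v \<noteq> []"
proof
  have "[0..<n] = [0..<m] @ [m..<n]" using assms by (metis le0 less_imp_le upt_add_eq_append le_add_diff_inverse)
  then show "zigzag n = zigzag m @ map (\<lambda>i. if even i then 3 else 4) [m..<n]"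
    by (simp add: zigzag_def)
  show "map (\<lambda>i. if even i then 3 else (4::nat)) [m..<n] \<noteq> []" using assms by simp
qed

text \<open>Since one of \<open>u\<^sub>m\<close> and \<open>u\<^sub>n\<close> is a proper prefix of the other, applying \<open>u\<^sub>n\<^sup>-\<^sup>1\<close> to a stack that
  starts with \<open>u\<^sub>m 5\<close> leaves a nonempty alternating block of \<open>3\<close>s and \<open>4\<close>s on top and never reaches
  the \<open>5\<close>.  After that nothing cancels: \<open>5\<close> and then \<open>u\<^sub>n\<close> are pushed.\<close>

lemma spike_act:
  assumes W: "distinct_adj W" "W = [] \<or> (\<exists>m r. m \<noteq> n \<and> W = zigzag m @ 5 # r)"
  obtains r where "foldr stack_act (spike n) W = zigzag n @ 5 # r"
proof -
  \<comment> \<open>The stack after \<open>u\<^sub>n\<^sup>-\<^sup>1\<close>; all that is needed of it is that \<open>5\<close> is not on top.\<close>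
  have "\<exists>V. foldr stack_act (rev (zigzag n)) W = V \<and> distinct_adj V \<and> (V = [] \<or> hd V \<noteq> 5)"
  proof -
    consider "W = []" | m r where "m < n" "W = zigzag m @ 5 # r"
      | m r where "n < m" "W = zigzag m @ 5 # r"
      using W(2) by (metis nat_neq_iff)
    then show ?thesis
    proof cases
      case 1
      then have "foldr stack_act (rev (zigzag n)) W = rev (zigzag n)"
        using foldr_stack_act_push[of "rev (zigzag n)" W] distinct_adj_zigzag by simp
      moreover have "5 \<notin> set (rev (zigzag n))"
        using set_zigzag[of n] by auto
      ultimately show ?thesis
        using distinct_adj_zigzag by (metis distinct_adj_rev hd_in_set)
    next
      case 2
      obtain v where v: "zigzag n = zigzag m @ v" "v \<noteq> []" using zigzag_prefix[OF 2(1)] .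
      have sv: "set v \<subseteq> {3,4}" using v set_zigzag[of n] by auto
      have dv: "distinct_adj v" using distinct_adj_zigzag[of n] v
        by (simp add: distinct_adj_append_iff)
      have d: "distinct_adj (rev v @ 5 # r)"
        using W(1) 2 dv sv v(2) 
        by (auto simp: distinct_adj_append_iff last_rev dest: hd_in_set)
      have "foldr stack_act (rev (zigzag n)) W = rev v @ 5 # r"
        using foldr_stack_act_pop[of "zigzag m" "5 # r"] foldr_stack_act_push[OF d]
        by (simp add: v 2)
      moreover have "hd (rev v @ 5 # r) \<in> set v" using v(2) by (simp add: hd_rev)
      ultimately show ?thesis using d sv by auto
    next
      case 3
      obtain v where v: "zigzag m = zigzag n @ v" "v \<noteq> []" using zigzag_prefix[OF 3(1)] .
      have sv: "set v \<subseteq> {3,4}" using v set_zigzag[of m] by auto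
      have "foldr stack_act (rev (zigzag n)) W = v @ 5 # r"
        using foldr_stack_act_pop[of "zigzag n" "v @ 5 # r"] by (simp add: v 3)
      moreover have "hd (v @ 5 # r) \<in> set v" using v(2) by simp
      moreover have "distinct_adj (v @ 5 # r)" using W(1) unfolding 3 v
        by (simp add: distinct_adj_append_iff)
      ultimately show ?thesis using sv by auto
    qed
  qed
  then obtain V where V: "foldr stack_act (rev (zigzag n)) W = V" "distinct_adj V"
    "V = [] \<or> hd V \<noteq> 5" by blast
  have "last (zigzag n) \<noteq> 5" if "zigzag n \<noteq> []"
    using last_in_set[OF that] set_zigzag[of n] by auto
  then have "distinct_adj ((zigzag n @ [5]) @ V)"
    using V distinct_adj_zigzag[of n]
    by (cases V) (auto simp: distinct_adj_append_iff)
  then have "foldr stack_act (zigzag n @ [5]) V = (zigzag n @ [5]) @ V"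
    by (rule foldr_stack_act_push)
  then have "foldr stack_act (spike n) W = zigzag n @ 5 # V"
    by (simp add: spike_def V(1))
  then show ?thesis by (rule that)
qed

lemma spikes_act:
  assumes "distinct_adj ns" "ns \<noteq> []"
  shows "\<exists>r. foldr stack_act (concat (map spike ns)) [] = zigzag (hd ns) @ 5 # r"
  using assms
proof (induction ns)
  case (Cons n ns)
  let ?W = "foldr stack_act (concat (map spike ns)) []"
  have "\<forall>t\<in>set (concat (map spike ns)). t > 2" 
    using set_zigzag by (auto simp: spike_def dest!: subsetD[OF set_zigzag])
  then have "distinct_adj ?W"
    by (intro foldr_stack_act(2)) auto
  moreover have "?W = [] \<or> (\<exists>m r. m \<noteq> n \<and> ?W = zigzag m @ 5 # r)"
    using Cons by (cases ns) (auto simp: distinct_adj_Cons)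
  ultimately obtain r where "foldr stack_act (spike n) ?W = zigzag n @ 5 # r"
    by (rule spike_act)
  then show ?case by simp
qed simp

section \<open>Homomorphisms out of a free group\<close>

text \<open>The value of a word after substituting \<open>h s\<close> for the letter \<open>s\<close>.  Substituting the letters
  themselves gives \<^const>\<open>word_eval\<close>, so the same lemmas serve the source and the target of a
  homomorphism.\<close>

primrec word_value :: "('b, 'c) monoid_scheme \<Rightarrow> ('a \<Rightarrow> 'b) \<Rightarrow> ('a \<times> bool) list \<Rightarrow> 'b" where
  "word_value H h [] = \<one>\<^bsub>H\<^esub>"
| "word_value H h (p # w) =
     (if snd p then h (fst p) else inv\<^bsub>H\<^esub> (h (fst p))) \<otimes>\<^bsub>H\<^esub> word_value H h w"

lemma word_eval_eq_word_value: "word_eval G w = word_value G (\<lambda>s. s) w"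
  by (induction w) auto

lemma (in group) word_value_closed:
  "h \<in> S \<rightarrow> carrier G \<Longrightarrow> w \<in> lists (S \<times> UNIV) \<Longrightarrow> word_value G h w \<in> carrier G"
  by (induction w) (auto simp: Pi_iff)

lemma (in group) word_value_append:
  assumes "h \<in> S \<rightarrow> carrier G" "v \<in> lists (S \<times> UNIV)" "w \<in> lists (S \<times> UNIV)"
  shows "word_value G h (v @ w) = word_value G h v \<otimes> word_value G h w"
  using assms(2)
proof (induction v)
  case Nil
  then show ?case using word_value_closed[OF assms(1,3)] by simp
next
  case (Cons p v)
  have "h (fst p) \<in> carrier G" using assms(1) Cons by auto
  then show ?case
    using Cons word_value_closed[OF assms(1)] assms(3) by (auto simp: m_assoc)
qed

text \<open>Prepending a letter to a reduced word causes at most one cancellation, so free reduction is a fold.\<close>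

fun reduce_Cons :: "'a \<times> bool \<Rightarrow> ('a \<times> bool) list \<Rightarrow> ('a \<times> bool) list" where
  "reduce_Cons p [] = [p]"
| "reduce_Cons p (q # w) = (if fst p = fst q \<and> snd p \<noteq> snd q then w else p # q # w)"

definition free_reduce :: "('a \<times> bool) list \<Rightarrow> ('a \<times> bool) list" where
  "free_reduce w = foldr reduce_Cons w []"

lemma reduced_word_reduce_Cons: "reduced_word w \<Longrightarrow> reduced_word (reduce_Cons p w)"
  by (cases w) (auto simp: reduced_word_def successively_Cons)

lemma free_reduce_reduced: "w \<in> lists (S \<times> UNIV) \<Longrightarrow> free_reduce w \<in> reduced_words S"
proof (induction w)
  case Nil
  then show ?case by (simp add: free_reduce_def reduced_words_def reduced_word_def)
next
  case (Cons p w)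
  have "free_reduce w \<in> reduced_words S" using Cons by simp
  then show ?case
    using Cons(2) reduced_word_reduce_Cons[of "free_reduce w" p]
    by (cases "free_reduce w") (auto simp: free_reduce_def reduced_words_def)
qed

lemma (in group) word_value_reduce_Cons:
  assumes h: "h \<in> S \<rightarrow> carrier G" and pw: "p # w \<in> lists (S \<times> UNIV)"
  shows "word_value G h (reduce_Cons p w) = word_value G h (p # w)"
proof (cases w)
  case (Cons q v)
  have c: "h (fst q) \<in> carrier G" "word_value G h v \<in> carrier G"
    using h pw Cons word_value_closed[OF h, of v] by auto
  show ?thesis
  proof (cases "fst p = fst q \<and> snd p \<noteq> snd q")
    case True
    then show ?thesis using c Cons
      by (cases "snd p") (auto simp: m_assoc[symmetric])
  qed (use Cons in auto)
qed simp

lemma (in group) word_value_free_reduce: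
  assumes h: "h \<in> S \<rightarrow> carrier G" and w: "w \<in> lists (S \<times> UNIV)"
  shows "word_value G h (free_reduce w) = word_value G h w"
  using w
proof (induction w)
  case (Cons p w)
  have p: "p \<in> S \<times> UNIV" and w: "w \<in> lists (S \<times> UNIV)"
    using Cons.hyps by simp_all
  have "free_reduce w \<in> lists (S \<times> UNIV)"
    using free_reduce_reduced[OF w] by (simp add: reduced_words_def)
  then have "p # free_reduce w \<in> lists (S \<times> UNIV)"
    using p by simp
  then have "word_value G h (reduce_Cons p (free_reduce w)) = word_value G h (p # free_reduce w)"
    by (rule word_value_reduce_Cons[OF h])
  then show ?case using Cons.IH by (simp add: free_reduce_def)
qed (simp add: free_reduce_def)

text \<open>The universal property of a free group.  The product of the values of two reduced words is the value of
  the free reduction of their concatenation, and free reduction preserves values in every group; so the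
  same reduced word describes the product in the source and in the target.\<close>

lemma free_basis_extend:
  assumes G: "group G" and H: "group H" and S: "free_basis G S" and h: "h \<in> S \<rightarrow> carrier H"
  obtains \<phi> where "\<phi> \<in> hom G H"
    and "\<And>w. w \<in> reduced_words S \<Longrightarrow> \<phi> (word_eval G w) = word_value H h w"
proof
  interpret G: group G by (rule G)
  interpret H: group H by (rule H)
  let ?R = "reduced_words S"
  let ?\<phi> = "\<lambda>g. word_value H h (inv_into ?R (word_eval G) g)"
  have bij: "bij_betw (word_eval G) ?R (carrier G)" and SG: "(\<lambda>s. s) \<in> S \<rightarrow> carrier G"
    using S by (auto simp: free_basis_def)
  show \<phi>: "?\<phi> (word_eval G w) = word_value H h w" if "w \<in> ?R" for w
    using that bij by (simp add: bij_betw_inv_into_left)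
  have R: "w \<in> lists (S \<times> UNIV)" if "w \<in> ?R" for w
    using that by (simp add: reduced_words_def)
  show "?\<phi> \<in> hom G H"
  proof (rule homI)
    fix g assume "g \<in> carrier G"
    then have "inv_into ?R (word_eval G) g \<in> ?R" using bij by (metis bij_betw_def inv_into_into)
    then show "?\<phi> g \<in> carrier H" using H.word_value_closed[OF h] R by blast
  next
    fix g k assume "g \<in> carrier G" "k \<in> carrier G"
    then obtain v w where v: "v \<in> ?R" "g = word_eval G v" and w: "w \<in> ?R" "k = word_eval G w"
      using bij by (metis bij_betw_def imageE)
    have vw: "v @ w \<in> lists (S \<times> UNIV)" using R v w by simp
    have "g \<otimes>\<^bsub>G\<^esub> k = word_eval G (free_reduce (v @ w))"
      using G.word_value_append[OF SG] G.word_value_free_reduce[OF SG vw] R v w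
      by (simp add: word_eval_eq_word_value)
    then have "?\<phi> (g \<otimes>\<^bsub>G\<^esub> k) = word_value H h (free_reduce (v @ w))"
      using \<phi>[OF free_reduce_reduced[OF vw]] by simp
    also have "\<dots> = word_value H h v \<otimes>\<^bsub>H\<^esub> word_value H h w"
      using H.word_value_append[OF h] H.word_value_free_reduce[OF h vw] R v w by simp
    finally show "?\<phi> (g \<otimes>\<^bsub>G\<^esub> k) = ?\<phi> g \<otimes>\<^bsub>H\<^esub> ?\<phi> k"
      using \<phi> v w by simp
  qed
qed

section \<open>The embedding\<close>

text \<open>The indices of the involutions in \<open>x\<^bsub>2k\<^esub> x\<^bsub>2k+1\<^esub>\<close> and in its inverse, for the \<open>k\<close>-th generator.\<close>

definition spike_word :: "nat \<times> bool \<Rightarrow> nat list" where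
  "spike_word p = (if snd p then [2 * fst p, 2 * fst p + 1] else [2 * fst p + 1, 2 * fst p])"

text \<open>Neighbouring indices from different generators differ after halving.  Two neighbouring copies of the same
  generator have the same exponent in a reduced word, so the last index of one copy and the first index of
  the next have different parity.\<close>

lemma distinct_adj_spike_word:
  assumes "reduced_word w"
  shows "distinct_adj (concat (map spike_word w))"
  using assms
proof (induction w)
  case (Cons p w)
  show ?case
  proof (cases w)
    case Nil
    then show ?thesis by (simp add: spike_word_def)
  next
    case (Cons q v)
    have *: "distinct_adj (concat (map spike_word w))" "fst p = fst q \<longrightarrow> snd p = snd q"
      using Cons.IH Cons.prems Cons by (auto simp: reduced_word_def split: prod.splits)
    have "2 * fst p \<noteq> Suc (2 * fst q)" "Suc (2 * fst p) \<noteq> 2 * fst q" by presburger+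
    then show ?thesis
      using * unfolding Cons by (auto simp: spike_word_def[of p] spike_word_def[of q] split: if_splits)
  qed
qed simp

lemma reduced_word_map:
  assumes "reduced_word w" "inj_on f (fst ` set w)"
  shows "reduced_word (map (apfst f) w)"
  using assms unfolding reduced_word_def successively_map
  by (auto elim!: successively_mono simp: inj_on_def split: prod.splits)

lemma set_spike: "set (spike n) \<subseteq> {3..5}"
  using set_zigzag by (fastforce simp: spike_def)

theorem lemma5:
  fixes G :: "('a, 'b) monoid_scheme"
  assumes "free_group G" and "countable (carrier G)"
  shows "admits_pointy_action G"
proof -
  obtain S where G: "group G" and S: "free_basis G S"
    using assms(1) by (auto simp: free_group_def)
  interpret G: group G by (rule G)
  interpret H: group stack_group by (rule group_shift_Aut0) simp
  have bij: "bij_betw (word_eval G) (reduced_words S) (carrier G)" and SG: "S \<subseteq> carrier G"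
    using S by (auto simp: free_basis_def)
  obtain \<nu> :: "'a \<Rightarrow> nat" where \<nu>: "inj_on \<nu> S"
    using assms(2) SG by (meson countable_def countable_subset)
  define spikes where "spikes w = concat (map spike (concat (map spike_word (map (apfst \<nu>) w))))" for w
  have spikes_set: "set (spikes w) \<subseteq> {3..5}" for w
    using set_spike by (auto simp: spikes_def)
  define h where "h s = toggles (spikes [(s, True)])" for s
  have h: "h \<in> S \<rightarrow> carrier stack_group"
    using toggles_Aut0 spikes_set unfolding h_def by (fastforce intro!: toggles_Aut0)
  have spikes_letters: "set (spikes w) \<subseteq> {2..5}" for w
    using spikes_set[of w] by fastforce
  have inv_h: "inv\<^bsub>stack_group\<^esub> (h s) = toggles (spikes [(s, False)])" for s
    using toggles_rev[OF spikes_letters, of "[(s, True)]"]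
    by (simp add: h_def spikes_def spike_word_def rev_spike)
  have word_value_h: "word_value stack_group h w = toggles (spikes w)" for w
  proof (induction w)
    case Nil
    then show ?case by (simp add: spikes_def toggles_Nil)
  next
    case (Cons p w)
    have "spikes (p # w) = spikes [p] @ spikes w" by (simp add: spikes_def)
    moreover have "toggles (spikes [p]) = (if snd p then h (fst p) else inv\<^bsub>stack_group\<^esub> (h (fst p)))"
      by (cases p) (auto simp: h_def inv_h[unfolded h_def])
    ultimately show ?case using Cons toggles_append[OF spikes_letters spikes_letters] by simp
  qed
  obtain \<phi> where \<phi>: "\<phi> \<in> hom G stack_group"
    and \<phi>_word: "\<And>w. w \<in> reduced_words S \<Longrightarrow> \<phi> (word_eval G w) = word_value stack_group h w"
    using free_basis_extend[OF G H.is_group S h] by blast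
  interpret \<phi>: group_hom G stack_group \<phi>
    by unfold_locales (rule \<phi>)
  let ?x = "stack_config []"
  have x: "?x \<in> stack_shift" by (simp add: topspace_full_shift)
  \<comment> \<open>The empty stack has trivial stabilizer.\<close>
  have trivial: "g = \<one>\<^bsub>G\<^esub>" if g: "g \<in> carrier G" and fixed: "\<phi> g ?x = ?x" for g
  proof -
    obtain w where w: "w \<in> reduced_words S" "g = word_eval G w"
      using bij g by (metis bij_betw_def imageE)
    let ?ns = "concat (map spike_word (map (apfst \<nu>) w))"
    have red: "reduced_word w" "fst ` set w \<subseteq> S" using w(1) by (auto simp: reduced_words_def)
    then have adj: "distinct_adj ?ns"
      using \<nu> by (intro distinct_adj_spike_word reduced_word_map) (auto intro: inj_on_subset)
    have "foldr toggle (spikes w) ?x = ?x"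
      using fixed \<phi>_word[OF w(1)] w(2) x by (simp add: word_value_h toggles_def)
    moreover have "foldr toggle (spikes w) ?x = stack_config (foldr stack_act (spikes w) [])"
      using foldr_stack_act(1)[of "[]" "spikes w"] spikes_set[of w] by fastforce
    moreover have "\<forall>t\<in>set (foldr stack_act (spikes w) []). t > 2"
      using foldr_stack_act(3)[of "[]" "spikes w"] spikes_set[of w] by fastforce
    ultimately have "foldr stack_act (spikes w) [] = []"
      using stack_config_head[of "foldr stack_act (spikes w) []" 1] stack_config_head[of "[]" 1]
      by (auto simp: less_imp_le simp del: stack_config.simps)
    then have "?ns = []" using spikes_act[OF adj] by (auto simp: spikes_def)
    then have "w = []" by (cases w) (auto simp: spike_word_def split: if_splits)
    then show ?thesis using w by simp
  qed
  have free: "g = k" if g: "g \<in> carrier G" and k: "k \<in> carrier G" and eq: "\<phi> g ?x = \<phi> k ?x" for g k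
  proof -
    have "\<phi> (inv\<^bsub>G\<^esub> g \<otimes>\<^bsub>G\<^esub> k) ?x = \<phi> (inv\<^bsub>G\<^esub> g) (\<phi> k ?x)"
      using g k x by (simp add: mult_shift_Aut0 compose_eq del: \<phi>.hom_inv)
    also have "\<dots> = \<phi> (inv\<^bsub>G\<^esub> g \<otimes>\<^bsub>G\<^esub> g) ?x"
      unfolding eq[symmetric] using g x \<phi>.hom_mult[of "inv\<^bsub>G\<^esub> g" g]
      by (simp add: mult_shift_Aut0 compose_eq del: \<phi>.hom_inv \<phi>.hom_mult G.l_inv)
    also have "\<dots> = ?x" using g x by (simp add: one_shift_Aut0)
    finally have "inv\<^bsub>G\<^esub> g \<otimes>\<^bsub>G\<^esub> k = \<one>\<^bsub>G\<^esub>" using trivial g k by simp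
    then show ?thesis
      using g k G.inv_equality[of "inv\<^bsub>G\<^esub> g" k] by (metis G.inv_closed G.inv_inv)
  qed
  have "inj_on \<phi> (carrier G)"
    using free by (metis inj_onI)
  then have "\<phi> \<in> mon G stack_group" using \<phi> by (simp add: mon_def)
  moreover have "zero_finite 0 ?x"
    unfolding zero_finite_def by (rule finite_subset[of _ "{0, 1}"]) auto
  moreover have "inj_on (\<lambda>f. f ?x) (\<phi> ` carrier G)"
    using free by (auto intro!: inj_onI)
  ultimately show ?thesis
    unfolding admits_pointy_action_def pointy_def
    using \<phi>.img_is_subgroup x by (intro exI[of _ stack_alphabet] exI[of _ 0] exI[of _ \<phi>]) auto
qed

end
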